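(* Let $p,\eta\in(0,1)$ and, for $r>0$, let $P_{r,p}$, $\delta_k$, $\phi$ and the bulk $B_{r,p}(\eta)$ be as defined in the context, with $q=1-p$. Then, as $r\to\infty$ and uniformly for $k\in B_{r,p}(\eta)$, $$\log\left(\frac{P_{r,p}(k)}{\frac{q}{\sqrt{rp}}\,\phi(\delta_k)}\right) = (rp)^{-1/2}\left\{\frac{1+p}{6}\delta_k^3-\frac{1+p}{2}\delta_k\right\} + (rp)^{-1}\left\{-\frac{1+p+p^2}{12}\delta_k^4+\frac{p^2+1}{4}\delta_k^2-\frac{p^2+q}{12}\right\} + \mathcal{O}_p\left(\frac{1+|\delta_k|^5}{r^{3/2}\eta^4}\right),$$ and $$\frac{P_{r,p}(k)}{\frac{q}{\sqrt{rp}}\,\phi(\delta_k)} = 1 + (rp)^{-1/2}\left\{\frac{1+p}{6}\delta_k^3-\frac{1+p}{2}\delta_k\right\} + (rp)^{-1}\left\{\frac{(1+p)^2}{72}\delta_k^6-\frac{2+3p+2p^2}{12}\delta_k^4+\frac{3+2p+3p^2}{8}\delta_k^2-\frac{p^2+q}{12}\right\} + \mathcal{O}_p\left(\frac{1+|\delta_k|^9}{r^{3/2}\eta^4}\right).$$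
   Context: For real $r>0$, $p\in(0,1)$ and $q=1-p$, the $\mathrm{NegBin}(r,p)$ probability mass function is $P_{r,p}(k)=\frac{\Gamma(r+k)}{\Gamma(r)\,k!}q^r p^k$, $k\in\mathbb{N}_0=\{0,1,2,\dots\}$ (mean $rpq^{-1}$, variance $rpq^{-2}$). Set $\phi(z)=\frac{e^{-z^2/2}}{\sqrt{2\pi}}$ and $\delta_k=\frac{k-rpq^{-1}}{\sqrt{rpq^{-2}}}$ (which depends on $r,p$). The bulk is $$B_{r,p}(\eta)=\left\{k\in\mathbb{N}_0:\left|\frac{\delta_k}{\sqrt{rp}}\right|\le \eta\, r^{-1/3}\right\}.$$ Notation: $u=\mathcal{O}_p(v)$ means $\limsup_{r\to\infty}|u/v|<C_p$ where the constant $C_p>0$ may depend on $p$ only; "uniformly for $k\in B_{r,p}(\eta)$" means this holds for the supremum of $|u/v|$ over $k\in B_{r,p}(\eta)$. *)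

theory Defs
  imports "HOL-Probability.Probability"
begin

(* The library's negative binomial distribution only covers integral r; here r is real. *)
definition negbin_pmf :: "real \<Rightarrow> real \<Rightarrow> nat \<Rightarrow> real" where
  "negbin_pmf r p k = Gamma (r + real k) / (Gamma r * fact k) * (1 - p) powr r * p ^ k"

definition delta :: "real \<Rightarrow> real \<Rightarrow> nat \<Rightarrow> real" where
  "delta r p k = (real k - r * p / (1 - p)) / sqrt (r * p / (1 - p)\<^sup>2)"

definition bulk :: "real \<Rightarrow> real \<Rightarrow> real \<Rightarrow> nat set" where
  "bulk r p \<eta> = {k. \<bar>delta r p k / sqrt (r * p)\<bar> \<le> \<eta> * r powr (- 1 / 3)}"

(* u = O_p(v) as r tends to infinity, uniformly on the bulk. The functions u and v take the
   arguments eta, r, k. As C may depend on p only, it is chosen before eta. The supremum is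
   taken in ereal, so that it is -infinity when the bulk is empty (which is possible only for
   small r) and the limit superior always exists. *)
definition bigO_on_bulk ::
  "real \<Rightarrow> (real \<Rightarrow> real \<Rightarrow> nat \<Rightarrow> real) \<Rightarrow> (real \<Rightarrow> real \<Rightarrow> nat \<Rightarrow> real) \<Rightarrow> bool" where
  "bigO_on_bulk p u v \<longleftrightarrow>
     (\<exists>C>0. \<forall>\<eta>\<in>{0<..<1}.
        Limsup at_top (\<lambda>r. SUP k\<in>bulk r p \<eta>. ereal \<bar>u \<eta> r k / v \<eta> r k\<bar>) < ereal C)"

end

theory Submission
  imports Defs "HOL-Real_Asymp.Real_Asymp"
begin

text \<open>
The expansion comes from Stirling's formula. Write \<open>k\<close> as the mean \<open>r * p / q\<close> times \<open>1 + t\<close>, so that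
\<open>r + k = r / q * (1 + p * t)\<close>. After Stirling's formula for \<open>Gamma (r + k)\<close>, \<open>Gamma r\<close> and \<open>k!\<close>,
the logarithm of the mass function divided by the scaled normal density becomes

  \<open>r / q * ((1 + p * t) * ln (1 + p * t) - p * (1 + t) * ln (1 + t)) + \<delta>\<^sub>k\<^sup>2 / 2\<close>
  \<open>- (ln (1 + p * t) + ln (1 + t)) / 2 + (q / (1 + p * t) - 1 - q / (p * (1 + t))) / (12 * r)\<close>

up to the Stirling errors, of order \<open>1 / r\<^sup>2\<close> (\<open>ln_negbin_ratio_expansion\<close>). Since
\<open>t = \<delta>\<^sub>k / sqrt (r * p)\<close>, Taylor expansion of the three elementary functions at \<open>0\<close> gives the first
claim (\<open>ln_ratio_expansion\<close>), with remainders of orders \<open>r * t ^ 5\<close>, \<open>t ^ 3\<close> and \<open>t / r\<close>.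

The second claim follows by exponentiating (\<open>ratio_expansion\<close>). On the bulk \<open>\<bar>t\<bar>\<close> is at most
\<open>r powr (- 1 / 3)\<close>, so \<open>\<delta>\<^sub>k ^ 3 / sqrt (r * p)\<close> is bounded; hence so is the logarithm \<open>L\<close> of the
ratio, and \<open>exp L = 1 + L + L\<^sup>2 / 2\<close> up to a multiple of \<open>\<bar>L\<bar> ^ 3\<close>. That cube is the source of the
ninth power of \<open>\<delta>\<^sub>k\<close> in the error.

Uniformity in \<open>k\<close> is obtained by working with Landau symbols along a filter on pairs \<open>(r, k)\<close> that is
concentrated on the bulk. Stirling's formula with its \<open>1 / (12 x)\<close> term is derived here for real
arguments (\<open>stirling_remainder_bigo\<close>), from Euler's limit for Gamma and Legendre's duplication formula.
\<close>

section \<open>Stirling's formula for real arguments\<close>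

text \<open>The factor \<open>Gamma r\<close> with real \<open>r\<close> calls for Stirling's formula on the real line, including the term
\<open>1 / (12 x)\<close>: it is of the same order as the second correction in the expansion.\<close>

definition stirling_remainder :: "real \<Rightarrow> real" where
  "stirling_remainder x =
     ln (Gamma x) - ((x - 1/2) * ln x - x + ln (2 * pi) / 2 + 1 / (12 * x))"

lemma stirling_remainder_diff:
  assumes "x > 0"
  shows "stirling_remainder x - stirling_remainder (x + 1) =
         (x + 1/2) * ln ((x + 1) / x) - 1 - 1 / (12 * x * (x + 1))"
proof -
  have "x \<notin> \<int>\<^sub>\<le>\<^sub>0"
    using assms by (auto elim!: nonpos_Ints_cases)
  then have "ln (Gamma (x + 1)) = ln x + ln (Gamma x)"
    using assms Gamma_real_pos[OF assms] by (simp add: Gamma_plus1 ln_mult_pos)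
  moreover have ln_quot: "ln ((x + 1) / x) = ln (x + 1) - ln x"
    using assms by (simp add: ln_div)
  moreover have "1 / (12 * x) - 1 / (12 * (x + 1)) = 1 / (12 * x * (x + 1))"
    using assms by (simp add: field_simps)
  ultimately show ?thesis
    unfolding stirling_remainder_def ln_quot by (simp add: algebra_simps add_divide_distrib)
qed

text \<open>By the functional equation of Gamma, unit increments of the remainder are elementary functions.
They are of order \<open>1 / x ^ 4\<close>; comparing them with the increments of \<open>1 / x\<^sup>2\<close>, of order \<open>1 / x ^ 3\<close>,
makes the bound telescope.\<close>

lemma stirling_remainder_shift_bound:
  obtains C X where "X > 0"
    "\<And>x n. x \<ge> X \<Longrightarrow>
      \<bar>stirling_remainder x - stirling_remainder (x + real n)\<bar> \<le> C / x\<^sup>2"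
proof -
  have "(\<lambda>x::real. (x + 1/2) * ln ((x + 1) / x) - 1 - 1 / (12 * x * (x + 1)))
          \<in> O(\<lambda>x. 1 / x\<^sup>2 - 1 / (x + 1)\<^sup>2)"
    by real_asymp
  then obtain C where "C > 0" and ev: "\<forall>\<^sub>F x in at_top.
      norm ((x + 1/2) * ln ((x + 1) / x) - 1 - 1 / (12 * x * (x + 1)) :: real)
        \<le> C * norm (1 / x\<^sup>2 - 1 / (x + 1)\<^sup>2)"
    by (rule landau_o.bigE)
  then obtain X0 where X0: "\<And>x. x \<ge> X0 \<Longrightarrow>
      \<bar>(x + 1/2) * ln ((x + 1) / x) - 1 - 1 / (12 * x * (x + 1))\<bar>
        \<le> C * \<bar>1 / x\<^sup>2 - 1 / (x + 1)\<^sup>2\<bar>"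
    by (auto simp: eventually_at_top_linorder)
  define X where "X = max X0 1"
  have step: "\<bar>stirling_remainder x - stirling_remainder (x + 1)\<bar>
      \<le> C * (1 / x\<^sup>2 - 1 / (x + 1)\<^sup>2)" if "x \<ge> X" for x
  proof -
    have "x > 0" "x \<ge> X0" using that by (auto simp: X_def)
    moreover have "1 / x\<^sup>2 \<ge> 1 / (x + 1)\<^sup>2"
      using \<open>x > 0\<close> by (intro divide_left_mono power_mono mult_pos_pos) auto
    ultimately show ?thesis
      using X0[of x] by (simp add: stirling_remainder_diff)
  qed
  have telescope: "\<bar>stirling_remainder x - stirling_remainder (x + real n)\<bar>
      \<le> C * (1 / x\<^sup>2 - 1 / (x + real n)\<^sup>2)" if "x \<ge> X" for x n
  proof (induction n)
    case (Suc n)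
    show ?case
      using Suc step[of "x + real n"] that by (simp add: algebra_simps abs_le_iff)
  qed auto
  show ?thesis
  proof (rule that[of X C])
    show "X > 0" by (simp add: X_def)
    fix x :: real and n :: nat
    assume x: "x \<ge> X"
    have "C * (1 / x\<^sup>2 - 1 / (x + real n)\<^sup>2) \<le> C * (1 / x\<^sup>2)"
      using \<open>C > 0\<close> by (intro mult_left_mono) auto
    with telescope[OF x, of n] show
      "\<bar>stirling_remainder x - stirling_remainder (x + real n)\<bar> \<le> C / x\<^sup>2"
      by simp
  qed
qed

text \<open>This is Euler's limit \<open>n! n ^ z / (z (z + 1) \<dots> (z + n)) \<longlonglongrightarrow> Gamma z\<close> in logarithmic form. It says that
the remainder behaves along \<open>z + \<nat>\<close> as it does along the integers.\<close>

lemma stirling_remainder_shift_limit: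
  assumes "z > 0"
  shows "(\<lambda>n. stirling_remainder (z + real n + 1) - stirling_remainder (real n + 1))
           \<longlonglongrightarrow> 0"
proof -
  have nonpole: "z \<notin> \<int>\<^sub>\<le>\<^sub>0"
    using assms by (auto elim!: nonpos_Ints_cases)
  have Gz: "Gamma z > 0" using assms by (rule Gamma_real_pos)
  have "(\<lambda>n. ln (Gamma_series z n)) \<longlonglongrightarrow> ln (Gamma z)"
    using Gz by (intro tendsto_intros) auto
  then have lim: "(\<lambda>n. ln (Gamma z) - ln (Gamma_series z n)) \<longlonglongrightarrow> 0"
    by (auto intro: tendsto_eq_intros)
  have eq: "ln (Gamma z) - ln (Gamma_series z n) =
      ln (Gamma (z + real n + 1)) - ln (Gamma (real n + 1)) - z * ln (real n)" for n
  proof -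
    have G: "Gamma (z + real n + 1) > 0" "Gamma (real n + 1) > 0"
      using assms by (auto intro!: Gamma_real_pos)
    have "Gamma_series z n =
        Gamma (real n + 1) * exp (z * ln (real n)) / (Gamma (z + real n + 1) / Gamma z)"
      unfolding Gamma_series_def
      using pochhammer_Gamma[OF nonpole, of "Suc n"] Gamma_fact[of n, where 'a=real]
      by (simp add: add_ac)
    moreover have "ln (a * exp y / (b / c)) = ln a + y - (ln b - ln c)"
      if "a > 0" "b > 0" "c > 0" for a b c y :: real
      using that by (simp add: ln_mult ln_div)
    ultimately have "ln (Gamma_series z n) =
        ln (Gamma (real n + 1)) + z * ln (real n) - (ln (Gamma (z + real n + 1)) - ln (Gamma z))"
      using G Gz by (simp only:)
    then show ?thesis by simp
  qed
  have "(\<lambda>n. ((z + real n + 1 - 1/2) * ln (z + real n + 1) - (z + real n + 1)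
              + 1 / (12 * (z + real n + 1)))
           - ((real n + 1 - 1/2) * ln (real n + 1) - (real n + 1) + 1 / (12 * (real n + 1)))
           - z * ln (real n)) \<longlonglongrightarrow> 0"
    by real_asymp
  from tendsto_diff[OF lim[unfolded eq] this] show ?thesis
    unfolding stirling_remainder_def by (simp add: algebra_simps)
qed

text \<open>Legendre's duplication formula is what identifies the constant \<open>ln (2 * pi) / 2\<close>: with any
other constant the limit would not vanish.\<close>

lemma stirling_remainder_duplication_limit:
  "((\<lambda>z. stirling_remainder z + stirling_remainder (z + 1/2) - stirling_remainder (2 * z))
     \<longlongrightarrow> 0) at_top"
proof -
  have eq: "ln (Gamma z) + ln (Gamma (z + 1/2)) - ln (Gamma (2 * z)) =
      (1 - 2 * z) * ln 2 + ln pi / 2" if "z > 0" for z :: real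
  proof -
    have G: "Gamma z > 0" "Gamma (z + 1/2) > 0" "Gamma (2 * z) > 0"
      using that by (auto intro!: Gamma_real_pos)
    have "Gamma z * Gamma (z + 1/2) = exp ((1 - 2 * z) * ln 2) * sqrt pi * Gamma (2 * z)"
    proof -
      have "z \<notin> \<int>\<^sub>\<le>\<^sub>0" "z + 1/2 \<notin> \<int>\<^sub>\<le>\<^sub>0"
        using that by (auto elim!: nonpos_Ints_cases)
      then have "complex_of_real z \<notin> \<int>\<^sub>\<le>\<^sub>0" "complex_of_real z + 1/2 \<notin> \<int>\<^sub>\<le>\<^sub>0"
        using of_real_in_nonpos_Ints_iff[of z, where 'a=complex]
              of_real_in_nonpos_Ints_iff[of "z + 1/2", where 'a=complex] by auto
      from Gamma_legendre_duplication[OF this]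
      have "complex_of_real (Gamma z * Gamma (z + 1/2)) =
          complex_of_real (exp ((1 - 2 * z) * ln 2) * sqrt pi * Gamma (2 * z))"
        by (simp add: Gamma_complex_of_real[symmetric] exp_of_real[symmetric])
      then show ?thesis by (simp only: of_real_eq_iff)
    qed
    then have "ln (Gamma z * Gamma (z + 1/2)) =
        ln (exp ((1 - 2 * z) * ln 2) * sqrt pi * Gamma (2 * z))" by simp
    then show ?thesis using G by (simp add: ln_mult_pos ln_sqrt)
  qed
  have "((\<lambda>z::real. (1 - 2 * z) * ln 2 + ln pi / 2 - ln (2 * pi) / 2
      - ((z - 1/2) * ln z - z + 1 / (12 * z))
      - (z * ln (z + 1/2) - (z + 1/2) + 1 / (12 * (z + 1/2)))
      + ((2 * z - 1/2) * ln (2 * z) - 2 * z + 1 / (12 * (2 * z))))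
      \<longlongrightarrow> ln 2 / 2 + ln pi / 2 - ln (2 * pi) / 2) at_top"
    by real_asymp
  moreover have "ln 2 / 2 + ln pi / 2 - ln (2 * pi) / 2 = (0::real)"
    by (simp add: ln_mult_pos add_divide_distrib)
  ultimately have "((\<lambda>z::real. (1 - 2 * z) * ln 2 + ln pi / 2 - ln (2 * pi) / 2
      - ((z - 1/2) * ln z - z + 1 / (12 * z))
      - (z * ln (z + 1/2) - (z + 1/2) + 1 / (12 * (z + 1/2)))
      + ((2 * z - 1/2) * ln (2 * z) - 2 * z + 1 / (12 * (2 * z)))) \<longlongrightarrow> 0) at_top"
    by (simp only:)
  then show ?thesis
  proof (rule Lim_transform_eventually)
    show "\<forall>\<^sub>F z in at_top. (1 - 2 * z) * ln 2 + ln pi / 2 - ln (2 * pi) / 2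
      - ((z - 1/2) * ln z - z + 1 / (12 * z))
      - (z * ln (z + 1/2) - (z + 1/2) + 1 / (12 * (z + 1/2)))
      + ((2 * z - 1/2) * ln (2 * z) - 2 * z + 1 / (12 * (2 * z)))
      = stirling_remainder z + stirling_remainder (z + 1/2) - stirling_remainder (2 * z)"
      using eventually_gt_at_top[of 0]
      by eventually_elim (use eq in \<open>simp add: stirling_remainder_def algebra_simps\<close>)
  qed
qed

text \<open>In the duplication limit the shift limit lets \<open>z + 1/2\<close> be replaced by \<open>z\<close>, and the shift bound
lets \<open>2 * z = z + z\<close> be replaced by \<open>z\<close> for integral \<open>z\<close>. One summand is left, so the
remainder tends to \<open>0\<close> along the integers, then along every \<open>x + \<nat>\<close>. Letting the shift go
to infinity in the shift bound gives the rate.\<close>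

theorem stirling_remainder_bigo: "stirling_remainder \<in> O(\<lambda>x. 1 / x\<^sup>2)"
proof -
  obtain C X where X: "X > 0"
    and C: "\<And>x n. x \<ge> X \<Longrightarrow>
      \<bar>stirling_remainder x - stirling_remainder (x + real n)\<bar> \<le> C / x\<^sup>2"
    by (rule stirling_remainder_shift_bound) blast
  let ?S = "\<lambda>n. stirling_remainder (real n + 1)"
  have nat_at_top: "filterlim (\<lambda>n. real n + 1) at_top sequentially"
    by real_asymp
  have dup: "(\<lambda>n. ?S n + stirling_remainder (real n + 1 + 1/2)
      - stirling_remainder (2 * (real n + 1))) \<longlonglongrightarrow> 0"
    by (rule filterlim_compose[OF stirling_remainder_duplication_limit nat_at_top])
  have half: "(\<lambda>n. stirling_remainder (real n + 1 + 1/2) - ?S n) \<longlonglongrightarrow> 0"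
    using stirling_remainder_shift_limit[of "1/2"] by (simp add: add_ac)
  have double: "(\<lambda>n. ?S n - stirling_remainder (2 * (real n + 1))) \<longlonglongrightarrow> 0"
  proof (rule Lim_null_comparison)
    show "(\<lambda>n. C / (real n + 1)\<^sup>2) \<longlonglongrightarrow> 0" by real_asymp
    show "\<forall>\<^sub>F n in sequentially.
        norm (?S n - stirling_remainder (2 * (real n + 1))) \<le> C / (real n + 1)\<^sup>2"
      using eventually_ge_at_top[of "nat \<lceil>X\<rceil>"]
    proof eventually_elim
      case (elim n)
      then have "X \<le> real n + 1" by linarith
      from C[OF this, of "Suc n"] show ?case by (simp add: algebra_simps)
    qed
  qed
  have S_lim: "?S \<longlonglongrightarrow> 0"
    using tendsto_diff[OF tendsto_diff[OF dup half] double] by simp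
  have "\<bar>stirling_remainder x\<bar> \<le> C / x\<^sup>2" if "x \<ge> X" for x
  proof -
    have "(\<lambda>n. stirling_remainder (x + real n + 1)) \<longlonglongrightarrow> 0"
      using tendsto_add[OF stirling_remainder_shift_limit[of x] S_lim] X that by simp
    then have "(\<lambda>n. \<bar>stirling_remainder x - stirling_remainder (x + real n + 1)\<bar>)
        \<longlonglongrightarrow> \<bar>stirling_remainder x - 0\<bar>"
      by (intro tendsto_intros)
    moreover have "\<bar>stirling_remainder x - stirling_remainder (x + real n + 1)\<bar> \<le> C / x\<^sup>2" for n
      using C[OF that, of "Suc n"] by (simp add: add_ac)
    ultimately show ?thesis
      using LIMSEQ_le_const2 by fastforce
  qed
  then show ?thesis
    by (intro bigoI[of _ C] eventually_at_top_linorderI[of X]) simp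
qed

section \<open>The logarithm of the mass function\<close>

text \<open>After Stirling's formula the logarithm of the mass function is a combination of
\<open>(1 + x) * ln (1 + x)\<close>, \<open>ln (1 + x)\<close> and \<open>inverse (1 + x)\<close>. Each is expanded just as far as the
theorem needs: the first one is multiplied by \<open>r\<close> and the last one by \<open>1 / r\<close>.\<close>

definition entropy_remainder :: "real \<Rightarrow> real" where
  "entropy_remainder x = (1 + x) * ln (1 + x) - (x + x\<^sup>2 / 2 - x ^ 3 / 6 + x ^ 4 / 12)"

definition ln_remainder :: "real \<Rightarrow> real" where
  "ln_remainder x = ln (1 + x) - (x - x\<^sup>2 / 2)"

definition inverse_remainder :: "real \<Rightarrow> real" where
  "inverse_remainder x = inverse (1 + x) - 1"

lemma bigo_nhdsI:
  assumes "f \<in> O[at a](g)" "f a = 0"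
  shows "f \<in> O[nhds a](g)"
proof -
  from assms(1) obtain C where "C > 0" "\<forall>\<^sub>F x in at a. norm (f x) \<le> C * norm (g x)"
    by (rule landau_o.bigE)
  with assms(2) have "\<forall>\<^sub>F x in nhds a. norm (f x) \<le> C * norm (g x)"
    by (simp add: eventually_nhds_conv_at)
  then show ?thesis by (rule bigoI)
qed

lemma entropy_remainder_bigo: "entropy_remainder \<in> O[nhds 0](\<lambda>x. x ^ 5)"
  unfolding entropy_remainder_def by (rule bigo_nhdsI) (real_asymp, simp)

lemma ln_remainder_bigo: "ln_remainder \<in> O[nhds 0](\<lambda>x. x ^ 3)"
  unfolding ln_remainder_def by (rule bigo_nhdsI) (real_asymp, simp)

lemma inverse_remainder_bigo: "inverse_remainder \<in> O[nhds 0](\<lambda>x. x)"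
  unfolding inverse_remainder_def by (rule bigo_nhdsI) (real_asymp, simp)

text \<open>The half-integer shift of the \<open>ln k\<close> term, opposite to that of the other two, comes from
\<open>k! = k * Gamma k\<close>.\<close>

lemma ln_negbin_pmf:
  assumes "0 < p" "p < 1" "r > 0" "k > 0"
  shows "ln (negbin_pmf r p k) =
    (r + k - 1/2) * ln (r + k) - (r - 1/2) * ln r - (k + 1/2) * ln k - ln (2 * pi) / 2
    + 1 / (12 * (r + k)) - 1 / (12 * r) - 1 / (12 * real k)
    + r * ln (1 - p) + k * ln p
    + (stirling_remainder (r + k) - stirling_remainder r - stirling_remainder k)"
proof -
  have G: "Gamma (r + k) > 0" "Gamma r > 0" "Gamma (real k) > 0"
    using assms by (auto intro!: Gamma_real_pos)
  then have nonzero: "Gamma (r + k) \<noteq> 0" "Gamma r \<noteq> 0" "Gamma (real k) \<noteq> 0"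
    by (metis less_irrefl)+
  have "real k \<notin> \<int>\<^sub>\<le>\<^sub>0"
    using assms by (auto elim!: nonpos_Ints_cases)
  then have "fact k = real k * Gamma (real k)"
    using Gamma_fact[of k, where 'a=real] Gamma_plus1[of "real k"] by (simp add: add_ac)
  then have "ln (negbin_pmf r p k) =
      ln (Gamma (r + k)) - ln (Gamma r) - ln k - ln (Gamma k) + r * ln (1 - p) + k * ln p"
    using assms nonzero by (simp add: negbin_pmf_def ln_mult ln_div ln_powr ln_realpow)
  then show ?thesis
    by (simp add: stirling_remainder_def algebra_simps)
qed

text \<open>With \<open>t\<close> the relative displacement of \<open>k\<close> from the mean, also
\<open>r + k = r / q * (1 + p * t)\<close>; hence all terms in \<open>ln r\<close>, \<open>ln p\<close> and \<open>ln q\<close> cancel and only the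
logarithms of \<open>1 + t\<close> and \<open>1 + p * t\<close> survive. The quadratic part of the entropy terms is
\<open>- d\<^sup>2 / 2\<close>, which the normal density removes. The identity is exact, the error being
expressed by the remainders.\<close>

lemma ln_negbin_ratio_expansion:
  fixes p q r t :: real and k :: nat
  assumes "0 < p" "p < 1" "q = 1 - p" "r > 0" "k > 0"
    and k_eq: "real k = r * p / q * (1 + t)" and d_eq: "d\<^sup>2 = r * p * t\<^sup>2"
  shows "ln (negbin_pmf r p k / (q / sqrt (r * p) * std_normal_density d)) =
      r * p * ((1 + p) / 6 * t ^ 3 - (1 + p + p\<^sup>2) / 12 * t ^ 4)
      - (1 + p) / 2 * t + (p\<^sup>2 + 1) / 4 * t\<^sup>2 - (p\<^sup>2 + q) / (12 * (r * p))
      + (r / q * (entropy_remainder (p * t) - p * entropy_remainder t)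
         - (ln_remainder (p * t) + ln_remainder t) / 2
         + (q * inverse_remainder (p * t) - q / p * inverse_remainder t) / (12 * r)
         + (stirling_remainder (r + k) - stirling_remainder r - stirling_remainder k))"
proof -
  let ?S = "stirling_remainder (r + k) - stirling_remainder r - stirling_remainder k"
  have q: "q > 0" using assms by simp
  have a: "1 + t > 0"
  proof -
    have "0 < r * p / q * (1 + t)" using assms(5) k_eq by linarith
    moreover have "r * p / q > 0" using assms q by simp
    ultimately show ?thesis by (rule zero_less_mult_pos)
  qed
  have rk: "r + k = r / q * (1 + p * t)"
    unfolding k_eq using q by (simp add: field_simps) (simp add: assms(3) algebra_simps)
  have b: "1 + p * t > 0"
  proof -
    have "0 < r / q * (1 + p * t)" using rk assms(4,5) by linarith
    moreover have "r / q > 0" using assms q by simp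
    ultimately show ?thesis by (rule zero_less_mult_pos)
  qed
  have pmf: "negbin_pmf r p k > 0"
    unfolding negbin_pmf_def using assms
    by (auto intro!: mult_pos_pos divide_pos_pos Gamma_real_pos)
  have ln_rk: "ln (r + k) = ln r - ln q + ln (1 + p * t)"
    unfolding rk using b q assms by (simp add: ln_mult ln_div)
  have ln_k: "ln k = ln r + ln p - ln q + ln (1 + t)"
    unfolding k_eq using a q assms by (simp add: ln_mult ln_div)
  have ln_normal: "ln (q / sqrt (r * p) * std_normal_density d) =
      ln q - (ln r + ln p) / 2 - ln (2 * pi) / 2 - d\<^sup>2 / 2"
    using q assms by (simp add: std_normal_density_def ln_mult ln_div ln_sqrt)
  have "ln (negbin_pmf r p k / (q / sqrt (r * p) * std_normal_density d)) =
      ln (negbin_pmf r p k) - ln (q / sqrt (r * p) * std_normal_density d)"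
    using pmf q assms
    by (intro ln_divide_pos mult_pos_pos divide_pos_pos normal_density_pos) auto
  also have "\<dots> = (r + k - 1/2) * ln (r + k) - (r - 1/2) * ln r - (k + 1/2) * ln k
      + (1 / (12 * (r + k)) - 1 / (12 * r) - 1 / (12 * real k))
      + r * ln q + k * ln p - ln q + (ln r + ln p) / 2 + d\<^sup>2 / 2 + ?S"
    unfolding ln_normal ln_negbin_pmf[OF assms(1,2,4,5), folded assms(3)] by simp
  also have "\<dots> = ((r + k) * ln (1 + p * t) - k * ln (1 + t))
      - (ln (1 + p * t) + ln (1 + t)) / 2
      + (1 / (12 * (r + k)) - 1 / (12 * r) - 1 / (12 * real k)) + d\<^sup>2 / 2 + ?S"
    unfolding ln_rk ln_k by (simp add: algebra_simps add_divide_distrib diff_divide_distrib)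
  also have "(r + k) * ln (1 + p * t) - k * ln (1 + t) =
      r / q * (entropy_remainder (p * t) - p * entropy_remainder t)
      + (r * p * ((1 + p) / 6 * t ^ 3 - (1 + p + p\<^sup>2) / 12 * t ^ 4) - d\<^sup>2 / 2)"
  proof -
    have poly: "(p * t + (p * t)\<^sup>2 / 2 - (p * t) ^ 3 / 6 + (p * t) ^ 4 / 12)
        - p * (t + t\<^sup>2 / 2 - t ^ 3 / 6 + t ^ 4 / 12)
        = q * (p * ((1 + p) / 6 * t ^ 3 - (1 + p + p\<^sup>2) / 12 * t ^ 4) - p * t\<^sup>2 / 2)"
      unfolding assms(3) by (simp add: field_simps) algebra
    have "(r + k) * ln (1 + p * t) - k * ln (1 + t) =
        r / q * ((1 + p * t) * ln (1 + p * t) - p * ((1 + t) * ln (1 + t)))"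
      unfolding rk unfolding k_eq by (simp add: algebra_simps add_divide_distrib)
    also have "\<dots> = r / q * (entropy_remainder (p * t) - p * entropy_remainder t)
        + r / q * ((p * t + (p * t)\<^sup>2 / 2 - (p * t) ^ 3 / 6 + (p * t) ^ 4 / 12)
                    - p * (t + t\<^sup>2 / 2 - t ^ 3 / 6 + t ^ 4 / 12))"
      unfolding entropy_remainder_def distrib_left[symmetric]
      by (intro arg_cong[where f = "\<lambda>z. r / q * z"]) (simp add: right_diff_distrib)
    also have "r / q * ((p * t + (p * t)\<^sup>2 / 2 - (p * t) ^ 3 / 6 + (p * t) ^ 4 / 12)
                    - p * (t + t\<^sup>2 / 2 - t ^ 3 / 6 + t ^ 4 / 12))
        = r * p * ((1 + p) / 6 * t ^ 3 - (1 + p + p\<^sup>2) / 12 * t ^ 4) - d\<^sup>2 / 2"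
      unfolding poly d_eq using q by (simp add: field_simps)
    finally show ?thesis .
  qed
  also have "1 / (12 * (r + k)) - 1 / (12 * r) - 1 / (12 * real k) =
      (q * inverse_remainder (p * t) - q / p * inverse_remainder t) / (12 * r)
      - (p\<^sup>2 + q) / (12 * (r * p))"
  proof -
    have "1 / (12 * (r + k)) = q * (1 + inverse_remainder (p * t)) / (12 * r)"
      unfolding rk inverse_remainder_def using b by (simp add: divide_simps)
    moreover have "1 / (12 * real k) = q / p * (1 + inverse_remainder t) / (12 * r)"
      unfolding k_eq inverse_remainder_def using a by (simp add: divide_simps)
    moreover have "q / (12 * r) - 1 / (12 * r) - q / p / (12 * r) = - (p\<^sup>2 + q) / (12 * (r * p))"
      unfolding assms(3) using assms(1,4) by (simp add: field_simps power2_eq_square)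
    ultimately show ?thesis
      by (simp add: algebra_simps add_divide_distrib diff_divide_distrib)
  qed
  also have "ln (1 + p * t) + ln (1 + t) =
      ln_remainder (p * t) + ln_remainder t + (1 + p) * t - (p\<^sup>2 + 1) * t\<^sup>2 / 2"
    unfolding ln_remainder_def by (simp add: field_simps)
  finally show ?thesis
    by (simp add: algebra_simps add_divide_distrib diff_divide_distrib)
qed

section \<open>Orders of magnitude on the bulk\<close>

text \<open>Boundedness of \<open>f\<close> suffices in place of convergence to \<open>0\<close>. This matters because the logarithm of the
ratio is bounded on the bulk but does not tend to \<open>0\<close> uniformly.\<close>

lemma exp_remainder_bigo:
  fixes f :: "'a \<Rightarrow> real"
  assumes "f \<in> O[F](\<lambda>_. 1)"
  shows "(\<lambda>x. exp (f x) - (1 + f x + (f x)\<^sup>2 / 2)) \<in> O[F](\<lambda>x. f x ^ 3)"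
proof -
  obtain M where M: "\<forall>\<^sub>F x in F. norm (f x) \<le> M * norm (1 :: real)"
    using assms by (rule landau_o.bigE)
  show ?thesis
  proof (rule bigoI[of _ "exp M / 6"])
    show "\<forall>\<^sub>F x in F. norm (exp (f x) - (1 + f x + (f x)\<^sup>2 / 2)) \<le> exp M / 6 * norm (f x ^ 3)"
      using M
    proof eventually_elim
      case (elim x)
      obtain s where s: "\<bar>s\<bar> \<le> \<bar>f x\<bar>"
        "exp (f x) = (\<Sum>m<3. f x ^ m / fact m) + exp s / fact 3 * f x ^ 3"
        using Maclaurin_exp_le by blast
      have eq: "exp (f x) - (1 + f x + (f x)\<^sup>2 / 2) = exp s / 6 * f x ^ 3"
        using s(2) by (simp add: eval_nat_numeral)
      have "exp s \<le> exp M" using s(1) elim by simp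
      then show ?case
        unfolding eq by (simp add: abs_mult mult_right_mono)
    qed
  qed
qed

locale negbin_bulk =
  fixes p q :: real
  assumes p_pos: "0 < p" and p_less: "p < 1" and q_eq: "q = 1 - p"
begin

text \<open>Pairs \<open>(r, k)\<close> with \<open>r\<close> going to infinity and \<open>k\<close> anywhere in the bulk: a Landau estimate along
this filter is an estimate uniform in \<open>k\<close>. The largest bulk, \<open>\<eta> = 1\<close>, contains all the others,
so that one constant serves every \<open>\<eta>\<close>.\<close>

definition bulk_filter :: "(real \<times> nat) filter" where
  "bulk_filter = inf (filtercomap fst at_top) (principal {(r, k). k \<in> bulk r p 1})"

text \<open>In the parameters \<open>\<epsilon>\<close> and \<open>\<Delta>\<close> the displacement is \<open>\<epsilon> * \<Delta>\<close> and the expansion proceeds in powers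
of \<open>\<epsilon>\<close>.\<close>

definition \<epsilon> :: "real \<times> nat \<Rightarrow> real" where
  "\<epsilon> x = 1 / sqrt (fst x * p)"

definition \<Delta> :: "real \<times> nat \<Rightarrow> real" where
  "\<Delta> x = delta (fst x) p (snd x)"

text \<open>The powers of \<open>w\<close> measure growth in \<open>\<Delta>\<close>. Unlike \<open>1 + \<bar>\<Delta>\<bar> ^ n\<close> they multiply as powers do,
and \<open>w \<ge> 1\<close> makes them increasing in the exponent.\<close>

definition w :: "real \<times> nat \<Rightarrow> real" where
  "w x = 1 + \<bar>\<Delta> x\<bar>"

lemma q_pos: "q > 0"
  using p_less q_eq by simp

lemma w_ge_1: "w x \<ge> 1"
  by (simp add: w_def)

lemma eventually_bulk_filter_iff:
  "eventually P bulk_filter \<longleftrightarrow> (\<exists>R. \<forall>r\<ge>R. \<forall>k\<in>bulk r p 1. P (r, k))"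
  unfolding bulk_filter_def eventually_inf_principal eventually_filtercomap_at_top_linorder
  by auto

lemma fst_at_top: "filterlim fst at_top bulk_filter"
  unfolding bulk_filter_def
  by (rule filterlim_mono[OF filterlim_filtercomap order_refl inf_le1])

lemma eventually_fst_gt: "\<forall>\<^sub>F x in bulk_filter. fst x > c"
  using fst_at_top by (simp add: filterlim_at_top_dense)

lemma eventually_in_bulk:
  "\<forall>\<^sub>F x in bulk_filter. \<bar>\<epsilon> x * \<Delta> x\<bar> \<le> fst x powr (- 1 / 3)"
  unfolding bulk_filter_def eventually_inf_principal
  by (intro always_eventually) (auto simp: bulk_def \<epsilon>_def \<Delta>_def)

lemma eps_square: "fst x > 0 \<Longrightarrow> (\<epsilon> x)\<^sup>2 = 1 / (fst x * p)"
  using p_pos by (simp add: \<epsilon>_def power_divide)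

lemma k_eq:
  assumes "fst x > 0"
  shows "real (snd x) = fst x * p / q * (1 + \<epsilon> x * \<Delta> x)"
proof -
  have "sqrt (fst x * p / (1 - p)\<^sup>2) = sqrt (fst x * p) / q"
    using q_pos by (simp add: real_sqrt_divide q_eq)
  then have "\<epsilon> x * \<Delta> x = (real (snd x) * q - fst x * p) / (fst x * p)"
    using assms p_pos q_pos by (simp add: \<epsilon>_def \<Delta>_def delta_def field_simps flip: q_eq)
  then show ?thesis
    using assms p_pos q_pos by (simp add: field_simps)
qed

lemma displacement_tendsto_0: "((\<lambda>x. \<epsilon> x * \<Delta> x) \<longlongrightarrow> 0) bulk_filter"
proof (rule Lim_null_comparison)
  show "\<forall>\<^sub>F x in bulk_filter. norm (\<epsilon> x * \<Delta> x) \<le> fst x powr (- 1 / 3)"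
    using eventually_in_bulk by simp
  have "((\<lambda>r::real. r powr (- 1 / 3)) \<longlongrightarrow> 0) at_top"
    by real_asymp
  then show "((\<lambda>x. fst x powr (- 1 / 3)) \<longlongrightarrow> 0) bulk_filter"
    by (rule filterlim_compose[OF _ fst_at_top])
qed

lemma eventually_eps: "\<forall>\<^sub>F x in bulk_filter. 0 < \<epsilon> x \<and> \<epsilon> x \<le> 1"
  using eventually_fst_gt[of "1 / p"]
proof eventually_elim
  case (elim x)
  then have "fst x * p \<ge> 1" using p_pos by (simp add: field_simps)
  then show ?case by (simp add: \<epsilon>_def)
qed

text \<open>This is what the exponent \<open>- 1 / 3\<close> in the bulk is for: the displacement is at most
\<open>r powr (- 1 / 3)\<close>, and its cube is \<open>\<epsilon>\<^sup>2\<close> times \<open>\<epsilon> * \<bar>\<Delta>\<bar> ^ 3\<close>, where \<open>\<epsilon>\<^sup>2 = 1 / (r * p)\<close>.\<close>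

lemma eventually_eps_w_cubed: "\<forall>\<^sub>F x in bulk_filter. \<epsilon> x * w x ^ 3 \<le> 16"
  using eventually_eps eventually_in_bulk eventually_fst_gt[of 0]
proof eventually_elim
  case (elim x)
  have "w x \<le> 2 * max 1 \<bar>\<Delta> x\<bar>" by (simp add: w_def)
  then have "w x ^ 3 \<le> (2 * max 1 \<bar>\<Delta> x\<bar>) ^ 3"
    using w_ge_1[of x] by (intro power_mono) auto
  also have "\<dots> \<le> 8 * (1 + \<bar>\<Delta> x\<bar> ^ 3)"
  proof (cases "\<bar>\<Delta> x\<bar> \<le> 1")
    case True
    then show ?thesis by (simp add: max.absorb1)
  next
    case False
    then show ?thesis by (simp add: max.absorb2 power_mult_distrib)
  qed
  finally have "\<epsilon> x * w x ^ 3 \<le> \<epsilon> x * (8 * (1 + \<bar>\<Delta> x\<bar> ^ 3))"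
    using elim by (intro mult_left_mono) auto
  then have le: "\<epsilon> x * w x ^ 3 \<le> 8 * (\<epsilon> x + \<epsilon> x * \<bar>\<Delta> x\<bar> ^ 3)"
    by (simp add: algebra_simps)
  have "\<epsilon> x * \<bar>\<Delta> x\<bar> ^ 3 \<le> 1"
  proof -
    have "\<bar>\<epsilon> x * \<Delta> x\<bar> ^ 3 \<le> (fst x powr (- 1 / 3)) ^ 3"
      using elim by (intro power_mono) auto
    also have "\<dots> = fst x powr (- 1)"
      using elim by (subst powr_power) auto
    also have "\<dots> = 1 / fst x"
      using elim by (simp add: powr_minus_divide)
    also have "\<dots> = p * (\<epsilon> x)\<^sup>2"
      using elim p_pos by (simp add: eps_square)
    finally have "(\<epsilon> x)\<^sup>2 * (\<epsilon> x * \<bar>\<Delta> x\<bar> ^ 3) \<le> (\<epsilon> x)\<^sup>2 * p"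
      using elim by (simp add: abs_mult power_mult_distrib power3_eq_cube power2_eq_square mult_ac)
    then have "\<epsilon> x * \<bar>\<Delta> x\<bar> ^ 3 \<le> p" using elim by simp
    then show ?thesis using p_less by simp
  qed
  moreover have "\<epsilon> x \<le> 1" using elim by simp
  ultimately have "8 * (\<epsilon> x + \<epsilon> x * \<bar>\<Delta> x\<bar> ^ 3) \<le> 8 * (1 + 1)"
    by (intro mult_left_mono add_mono) auto
  with le show ?case by simp
qed

lemma eps_w_bigo_mono:
  assumes "b \<le> a" "i \<le> j"
  shows "(\<lambda>x. \<epsilon> x ^ a * w x ^ i) \<in> O[bulk_filter](\<lambda>x. \<epsilon> x ^ b * w x ^ j)"
proof (rule bigoI[of _ 1])
  show "\<forall>\<^sub>F x in bulk_filter. norm (\<epsilon> x ^ a * w x ^ i) \<le> 1 * norm (\<epsilon> x ^ b * w x ^ j)"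
    using eventually_eps
  proof eventually_elim
    case (elim x)
    have "\<epsilon> x ^ a * w x ^ i \<le> \<epsilon> x ^ b * w x ^ j"
      using assms elim w_ge_1[of x]
      by (intro mult_mono power_decreasing power_increasing) auto
    then show ?case
      using elim w_ge_1[of x] by simp
  qed
qed

lemma eps_w_cubed_bigo_1: "(\<lambda>x. \<epsilon> x * w x ^ 3) \<in> O[bulk_filter](\<lambda>_. 1)"
proof (rule bigoI[of _ 16])
  show "\<forall>\<^sub>F x in bulk_filter. norm (\<epsilon> x * w x ^ 3) \<le> 16 * norm (1::real)"
    using eventually_eps eventually_eps_w_cubed
  proof eventually_elim
    case (elim x)
    then show ?case using w_ge_1[of x] by simp
  qed
qed

lemma Delta_power_bigo: "i \<le> j \<Longrightarrow> (\<lambda>x. \<Delta> x ^ i) \<in> O[bulk_filter](\<lambda>x. w x ^ j)"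
proof (rule bigoI[of _ 1], rule always_eventually, rule allI)
  fix x assume "i \<le> j"
  have "\<bar>\<Delta> x\<bar> ^ i \<le> w x ^ i" by (intro power_mono) (auto simp: w_def)
  also have "\<dots> \<le> w x ^ j" using \<open>i \<le> j\<close> w_ge_1 by (rule power_increasing)
  finally show "norm (\<Delta> x ^ i) \<le> 1 * norm (w x ^ j)"
    using w_ge_1[of x] by (simp add: power_abs)
qed

text \<open>Serves for the three Gamma arguments \<open>r\<close>, \<open>k\<close> and \<open>r + k\<close>, all of order at least \<open>r\<close>.\<close>

lemma stirling_remainder_bulk_bigo:
  assumes "c > 0" "\<forall>\<^sub>F x in bulk_filter. f x \<ge> c * fst x"
  shows "(\<lambda>x. stirling_remainder (f x)) \<in> O[bulk_filter](\<lambda>x. \<epsilon> x ^ 3 * w x ^ 5)"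
proof -
  have "filterlim (\<lambda>x. c * fst x) at_top bulk_filter"
    using assms(1) fst_at_top by (rule filterlim_tendsto_pos_mult_at_top[OF tendsto_const])
  then have "filterlim f at_top bulk_filter"
    by (rule filterlim_at_top_mono) (rule assms(2))
  with stirling_remainder_bigo
  have "(\<lambda>x. stirling_remainder (f x)) \<in> O[bulk_filter](\<lambda>x. 1 / (f x)\<^sup>2)"
    by (rule landau_o.big.compose)
  also have "(\<lambda>x. 1 / (f x)\<^sup>2) \<in> O[bulk_filter](\<lambda>x. \<epsilon> x ^ 4 * w x ^ 0)"
  proof (rule bigoI[of _ "(p / c)\<^sup>2"])
    show "\<forall>\<^sub>F x in bulk_filter. norm (1 / (f x)\<^sup>2) \<le> (p / c)\<^sup>2 * norm (\<epsilon> x ^ 4 * w x ^ 0)"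
      using assms(2) eventually_fst_gt[of 0]
    proof eventually_elim
      case (elim x)
      have "0 < c * fst x" using elim assms(1) by simp
      then have "1 / (f x)\<^sup>2 \<le> 1 / (c * fst x)\<^sup>2"
        using elim assms(1) by (intro divide_left_mono power_mono mult_pos_pos zero_less_power) linarith+
      also have "\<dots> = (p / c)\<^sup>2 * ((\<epsilon> x)\<^sup>2)\<^sup>2"
        unfolding eps_square[OF elim(2)] using p_pos
        by (simp add: power_divide power_mult_distrib)
      finally show ?case by simp
    qed
  qed
  also have "(\<lambda>x. \<epsilon> x ^ 4 * w x ^ 0) \<in> O[bulk_filter](\<lambda>x. \<epsilon> x ^ 3 * w x ^ 5)"
    by (rule eps_w_bigo_mono) auto
  finally show ?thesis .
qed

lemma displacement_power_bigo:
  "(\<lambda>x. (\<epsilon> x * \<Delta> x) ^ n) \<in> O[bulk_filter](\<lambda>x. \<epsilon> x ^ n * w x ^ n)"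
  unfolding power_mult_distrib
  by (rule landau_o.big.mult[OF landau_o.big_refl Delta_power_bigo]) simp

lemma eventually_k_ge: "\<forall>\<^sub>F x in bulk_filter. real (snd x) \<ge> p / 2 * fst x"
proof -
  have "\<forall>\<^sub>F x in bulk_filter. \<epsilon> x * \<Delta> x > - 1/2"
    using displacement_tendsto_0 by (rule order_tendstoD) simp
  then show ?thesis using eventually_fst_gt[of 0]
  proof eventually_elim
    case (elim x)
    have "p / 2 * fst x \<le> fst x * p / q * (1 / 2)"
      using elim p_pos p_less q_pos q_eq by (simp add: field_simps)
    also have "\<dots> \<le> real (snd x)"
      unfolding k_eq[OF elim(2)] using elim p_pos q_pos by (intro mult_left_mono) auto
    finally show ?case .
  qed
qed

section \<open>The two expansions\<close>

definition first_correction :: "real \<times> nat \<Rightarrow> real" where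
  "first_correction x = (1 + p) / 6 * \<Delta> x ^ 3 - (1 + p) / 2 * \<Delta> x"

definition second_correction :: "real \<times> nat \<Rightarrow> real" where
  "second_correction x = - (1 + p + p\<^sup>2) / 12 * \<Delta> x ^ 4 + (p\<^sup>2 + 1) / 4 * (\<Delta> x)\<^sup>2 - (p\<^sup>2 + q) / 12"

definition ratio :: "real \<times> nat \<Rightarrow> real" where
  "ratio x = negbin_pmf (fst x) p (snd x) /
     (q / sqrt (fst x * p) * std_normal_density (\<Delta> x))"

lemma r_times_bigo:
  assumes "f \<in> O[bulk_filter](\<lambda>x. \<epsilon> x ^ (n + 2) * w x ^ m)"
  shows "(\<lambda>x. fst x * f x) \<in> O[bulk_filter](\<lambda>x. \<epsilon> x ^ n * w x ^ m)"
proof -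
  have "fst \<in> O[bulk_filter](\<lambda>x. inverse ((\<epsilon> x)\<^sup>2))"
  proof (rule bigoI[of _ "1 / p"])
    show "\<forall>\<^sub>F x in bulk_filter. norm (fst x) \<le> 1 / p * norm (inverse ((\<epsilon> x)\<^sup>2))"
      using eventually_fst_gt[of 0]
      by eventually_elim (use p_pos in \<open>simp add: eps_square\<close>)
  qed
  then have "(\<lambda>x. fst x * f x)
      \<in> O[bulk_filter](\<lambda>x. inverse ((\<epsilon> x)\<^sup>2) * (\<epsilon> x ^ (n + 2) * w x ^ m))"
    using assms by (rule landau_o.big.mult)
  also have "(\<lambda>x. inverse ((\<epsilon> x)\<^sup>2) * (\<epsilon> x ^ (n + 2) * w x ^ m))
      \<in> O[bulk_filter](\<lambda>x. \<epsilon> x ^ n * w x ^ m)"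
  proof (rule landau_o.big.in_cong[THEN iffD2])
    show "\<forall>\<^sub>F x in bulk_filter. inverse ((\<epsilon> x)\<^sup>2) * (\<epsilon> x ^ (n + 2) * w x ^ m) = \<epsilon> x ^ n * w x ^ m"
      using eventually_eps
      by eventually_elim (simp add: power_add power2_eq_square field_simps)
  qed simp
  finally show ?thesis .
qed

lemma ratio_pos: "fst x > 0 \<Longrightarrow> ratio x > 0"
  unfolding ratio_def negbin_pmf_def using p_pos p_less q_pos
  by (intro divide_pos_pos mult_pos_pos normal_density_pos) (auto intro!: Gamma_real_pos add_pos_nonneg)

text \<open>Substituting \<open>t = \<epsilon> * \<Delta>\<close> into the exact identity turns its polynomial part into the two
corrections. The remainders are of orders \<open>r * t ^ 5\<close>, \<open>t ^ 3\<close>, \<open>t / r\<close> and \<open>1 / r\<^sup>2\<close>; as \<open>r\<close> is a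
multiple of \<open>1 / \<epsilon>\<^sup>2\<close>, each has at least three factors \<open>\<epsilon>\<close> and at most five factors \<open>\<Delta>\<close>.\<close>

lemma ln_ratio_expansion:
  "(\<lambda>x. ln (ratio x) - (\<epsilon> x * first_correction x + (\<epsilon> x)\<^sup>2 * second_correction x))
     \<in> O[bulk_filter](\<lambda>x. \<epsilon> x ^ 3 * w x ^ 5)"
proof -
  let ?t = "\<lambda>x. \<epsilon> x * \<Delta> x"
  have pt: "((\<lambda>x. p * ?t x) \<longlongrightarrow> 0) bulk_filter"
    using tendsto_mult[OF tendsto_const displacement_tendsto_0, of p] by simp
  have scaled: "(\<lambda>x. (p * ?t x) ^ n) \<in> O[bulk_filter](\<lambda>x. \<epsilon> x ^ n * w x ^ n)" for n
    using displacement_power_bigo[of n] p_pos by (simp add: power_mult_distrib)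
  have entropy: "(\<lambda>x. entropy_remainder (p * ?t x) - p * entropy_remainder (?t x))
      \<in> O[bulk_filter](\<lambda>x. \<epsilon> x ^ (3 + 2) * w x ^ 5)"
    using landau_o.big_trans[OF landau_o.big.compose[OF entropy_remainder_bigo pt] scaled]
      landau_o.big_trans[OF landau_o.big.compose[OF entropy_remainder_bigo displacement_tendsto_0]
        displacement_power_bigo] p_pos
    by (intro sum_in_bigo) simp_all
  have R1: "(\<lambda>x. fst x / q * (entropy_remainder (p * ?t x) - p * entropy_remainder (?t x)))
      \<in> O[bulk_filter](\<lambda>x. \<epsilon> x ^ 3 * w x ^ 5)"
    using r_times_bigo[OF entropy] q_pos by (simp add: field_simps)
  have "(\<lambda>x. ln_remainder (p * ?t x) + ln_remainder (?t x))
      \<in> O[bulk_filter](\<lambda>x. \<epsilon> x ^ 3 * w x ^ 3)"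
    by (intro sum_in_bigo landau_o.big_trans[OF landau_o.big.compose[OF ln_remainder_bigo pt] scaled]
      landau_o.big_trans[OF landau_o.big.compose[OF ln_remainder_bigo displacement_tendsto_0]
        displacement_power_bigo])
  then have R2: "(\<lambda>x. (ln_remainder (p * ?t x) + ln_remainder (?t x)) / 2)
      \<in> O[bulk_filter](\<lambda>x. \<epsilon> x ^ 3 * w x ^ 5)"
    using landau_o.big_trans[OF _ eps_w_bigo_mono[of 3 3 3 5]] by simp
  have "(\<lambda>x. q * inverse_remainder (p * ?t x) - q / p * inverse_remainder (?t x))
      \<in> O[bulk_filter](\<lambda>x. \<epsilon> x ^ 1 * w x ^ 1)"
    using landau_o.big_trans[OF landau_o.big.compose[OF inverse_remainder_bigo pt]] scaled[of 1]
      landau_o.big_trans[OF landau_o.big.compose[OF inverse_remainder_bigo displacement_tendsto_0]]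
      displacement_power_bigo[of 1] p_pos q_pos
    by (intro sum_in_bigo) simp_all
  from landau_o.big.mult[OF landau_o.big_refl[of "\<lambda>x. (\<epsilon> x)\<^sup>2"] this]
  have "(\<lambda>x. (\<epsilon> x)\<^sup>2 * (q * inverse_remainder (p * ?t x) - q / p * inverse_remainder (?t x)))
      \<in> O[bulk_filter](\<lambda>x. \<epsilon> x ^ 3 * w x ^ 1)"
    by (simp add: power2_eq_square power3_eq_cube mult_ac)
  also have "(\<lambda>x. \<epsilon> x ^ 3 * w x ^ 1) \<in> O[bulk_filter](\<lambda>x. \<epsilon> x ^ 3 * w x ^ 5)"
    by (rule eps_w_bigo_mono) auto
  finally have R3: "(\<lambda>x. p / 12 *
      ((\<epsilon> x)\<^sup>2 * (q * inverse_remainder (p * ?t x) - q / p * inverse_remainder (?t x))))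
      \<in> O[bulk_filter](\<lambda>x. \<epsilon> x ^ 3 * w x ^ 5)"
    using p_pos by simp
  have R4: "(\<lambda>x. stirling_remainder (fst x + snd x) - stirling_remainder (fst x)
        - stirling_remainder (snd x)) \<in> O[bulk_filter](\<lambda>x. \<epsilon> x ^ 3 * w x ^ 5)"
    using p_pos
    by (intro sum_in_bigo stirling_remainder_bulk_bigo[of 1] stirling_remainder_bulk_bigo[of "p / 2"]
          eventually_k_ge always_eventually) auto
  have "\<forall>\<^sub>F x in bulk_filter. ln (ratio x) - (\<epsilon> x * first_correction x + (\<epsilon> x)\<^sup>2 * second_correction x) =
      fst x / q * (entropy_remainder (p * ?t x) - p * entropy_remainder (?t x))
      - (ln_remainder (p * ?t x) + ln_remainder (?t x)) / 2
      + p / 12 *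
        ((\<epsilon> x)\<^sup>2 * (q * inverse_remainder (p * ?t x) - q / p * inverse_remainder (?t x)))
      + (stirling_remainder (fst x + snd x) - stirling_remainder (fst x) - stirling_remainder (snd x))"
    using eventually_fst_gt[of 0] eventually_k_ge eventually_eps
  proof eventually_elim
    case (elim x)
    let ?r = "fst x" and ?k = "snd x"
    have e: "\<epsilon> x \<noteq> 0" using elim by simp
    have "0 < p / 2 * ?r" using elim p_pos by simp
    then have k: "?k > 0" using elim by linarith
    have rp: "?r * p = 1 / (\<epsilon> x)\<^sup>2" using elim p_pos by (simp add: eps_square)
    have d: "(\<Delta> x)\<^sup>2 = ?r * p * (?t x)\<^sup>2"
      unfolding rp using e by (simp add: power_mult_distrib)
    have inv_r: "y / (12 * ?r) = p / 12 * ((\<epsilon> x)\<^sup>2 * y)" for y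
      using elim p_pos by (simp add: eps_square)
    have "?r * p * ((1 + p) / 6 * ?t x ^ 3 - (1 + p + p\<^sup>2) / 12 * ?t x ^ 4)
        - (1 + p) / 2 * ?t x + (p\<^sup>2 + 1) / 4 * (?t x)\<^sup>2 - (p\<^sup>2 + q) / (12 * (?r * p))
        = \<epsilon> x * first_correction x + (\<epsilon> x)\<^sup>2 * second_correction x"
      unfolding rp first_correction_def second_correction_def using e
      by (simp add: power_mult_distrib field_simps eval_nat_numeral)
    then show ?case
      unfolding ratio_def
        ln_negbin_ratio_expansion[OF p_pos p_less q_eq elim(1) k k_eq[OF elim(1)] d] inv_r
      by simp
  qed
  then show ?thesis
    by (rule landau_o.big.in_cong[THEN iffD2]) (intro sum_in_bigo R1 R2 R3 R4)
qed

lemma first_correction_bigo: "first_correction \<in> O[bulk_filter](\<lambda>x. w x ^ 3)"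
  unfolding first_correction_def using Delta_power_bigo[of 3 3] Delta_power_bigo[of 1 3] p_pos
  by (intro sum_in_bigo) simp_all

lemma second_correction_bigo: "second_correction \<in> O[bulk_filter](\<lambda>x. w x ^ 4)"
proof -
  have "(\<lambda>x. c * \<Delta> x ^ i) \<in> O[bulk_filter](\<lambda>x. w x ^ 4)" if "i \<le> 4" for c i
    using Delta_power_bigo[OF that] by (cases "c = 0") simp_all
  from this[of 4] this[of 2] this[of 0 "(p\<^sup>2 + q) / 12"] show ?thesis
    unfolding second_correction_def by (intro sum_in_bigo) (simp_all only: power_0 mult_1_right)
qed

text \<open>With \<open>L\<close> the logarithm of the ratio and \<open>E\<close> its error term, exponentiate to second order. The
cubic error is \<open>L ^ 3\<close>, which has order \<open>(\<epsilon> * w ^ 3) ^ 3\<close> and so accounts for the exponent 9.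
In \<open>L\<^sup>2 / 2\<close> only the square of the first correction is kept; the rest is bounded by
factoring a difference of squares.\<close>

lemma ratio_expansion:
  "(\<lambda>x. ratio x - (1 + \<epsilon> x * first_correction x + (\<epsilon> x)\<^sup>2 * ((first_correction x)\<^sup>2 / 2 + second_correction x)))
     \<in> O[bulk_filter](\<lambda>x. \<epsilon> x ^ 3 * w x ^ 9)"
proof -
  let ?O = "\<lambda>a b. O[bulk_filter](\<lambda>x. \<epsilon> x ^ a * w x ^ b)"
  define L where "L = (\<lambda>x. ln (ratio x))"
  define E where "E = (\<lambda>x. L x - (\<epsilon> x * first_correction x + (\<epsilon> x)\<^sup>2 * second_correction x))"
  have E: "E \<in> ?O 3 5"
    using ln_ratio_expansion by (simp add: E_def L_def)
  have first_correction: "(\<lambda>x. \<epsilon> x * first_correction x) \<in> ?O 1 3"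
    using landau_o.big.mult[OF landau_o.big_refl first_correction_bigo, of \<epsilon>] by simp
  have second_correction: "(\<lambda>x. (\<epsilon> x)\<^sup>2 * second_correction x) \<in> ?O 2 4"
    by (rule landau_o.big.mult[OF landau_o.big_refl second_correction_bigo])
  have small: "(\<lambda>x. f x * g x) \<in> O[bulk_filter](g)"
    if "f \<in> O[bulk_filter](\<lambda>_. 1)" for f g :: "real \<times> nat \<Rightarrow> real"
    using landau_o.big.mult[OF that landau_o.big_refl, of g] by simp
  have eps_w: "(\<lambda>x. \<epsilon> x * w x) \<in> O[bulk_filter](\<lambda>_. 1)"
    using landau_o.big_trans[OF eps_w_bigo_mono[of 1 1 1 3] _] eps_w_cubed_bigo_1 by simp
  have "(\<lambda>x. \<epsilon> x ^ 3 * w x ^ 5) \<in> ?O 2 4"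
    using small[OF eps_w, of "\<lambda>x. \<epsilon> x ^ 2 * w x ^ 4"]
    by (simp add: eval_nat_numeral mult_ac)
  with E have E': "E \<in> ?O 2 4" by (rule landau_o.big_trans)
  have second: "(\<lambda>x. (\<epsilon> x)\<^sup>2 * second_correction x + E x) \<in> ?O 2 4"
    using second_correction E' by (rule sum_in_bigo)
  have "(\<lambda>x. \<epsilon> x ^ 2 * w x ^ 4) \<in> ?O 1 3"
    using small[OF eps_w, of "\<lambda>x. \<epsilon> x ^ 1 * w x ^ 3"]
    by (simp add: eval_nat_numeral mult_ac)
  with second have "(\<lambda>x. (\<epsilon> x)\<^sup>2 * second_correction x + E x) \<in> ?O 1 3"
    by (rule landau_o.big_trans)
  from sum_in_bigo(1)[OF first_correction this] have L: "L \<in> ?O 1 3"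
    by (simp add: E_def)
  have "L \<in> O[bulk_filter](\<lambda>_. 1)"
    using L eps_w_cubed_bigo_1 by (intro landau_o.big_trans[OF L]) simp
  then have "(\<lambda>x. exp (L x) - (1 + L x + (L x)\<^sup>2 / 2)) \<in> O[bulk_filter](\<lambda>x. L x ^ 3)"
    by (rule exp_remainder_bigo)
  also have "(\<lambda>x. L x ^ 3) \<in> ?O 3 9"
    using landau_o.big_power[OF L, of 3] by (simp add: power_mult_distrib flip: power_mult)
  finally have cubic: "(\<lambda>x. exp (L x) - (1 + L x + (L x)\<^sup>2 / 2)) \<in> ?O 3 9" .
  \<comment> \<open>The first factor is \<open>L - \<epsilon> * first_correction\<close>, so the product is \<open>L\<^sup>2 - (\<epsilon> * first_correction)\<^sup>2\<close>.\<close>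
  have "(\<lambda>x. ((\<epsilon> x)\<^sup>2 * second_correction x + E x) * (L x + \<epsilon> x * first_correction x))
      \<in> O[bulk_filter](\<lambda>x. (\<epsilon> x ^ 2 * w x ^ 4) * (\<epsilon> x ^ 1 * w x ^ 3))"
    by (intro landau_o.big.mult second sum_in_bigo L first_correction)
  also have "(\<lambda>x. (\<epsilon> x ^ 2 * w x ^ 4) * (\<epsilon> x ^ 1 * w x ^ 3)) = (\<lambda>x. \<epsilon> x ^ 3 * w x ^ 7)"
    by (simp add: eval_nat_numeral mult_ac)
  also have "(\<lambda>x. \<epsilon> x ^ 3 * w x ^ 7) \<in> ?O 3 9"
    by (rule eps_w_bigo_mono) auto
  finally have cross: "(\<lambda>x. ((\<epsilon> x)\<^sup>2 * second_correction x + E x) * (L x + \<epsilon> x * first_correction x) / 2) \<in> ?O 3 9"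
    by simp
  have E'': "E \<in> ?O 3 9"
    using E by (rule landau_o.big_trans) (rule eps_w_bigo_mono; simp)
  have "\<forall>\<^sub>F x in bulk_filter.
      ratio x - (1 + \<epsilon> x * first_correction x + (\<epsilon> x)\<^sup>2 * ((first_correction x)\<^sup>2 / 2 + second_correction x)) =
      (exp (L x) - (1 + L x + (L x)\<^sup>2 / 2)) + E x
      + ((\<epsilon> x)\<^sup>2 * second_correction x + E x) * (L x + \<epsilon> x * first_correction x) / 2"
    using eventually_fst_gt[of 0]
  proof eventually_elim
    case (elim x)
    have "exp (L x) = ratio x" using ratio_pos[OF elim] by (simp add: L_def)
    moreover have "(\<epsilon> x)\<^sup>2 * second_correction x + E x = L x - \<epsilon> x * first_correction x" by (simp add: E_def)
    ultimately show ?case by (simp add: E_def field_simps power2_eq_square)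
  qed
  then show ?thesis
    by (rule landau_o.big.in_cong[THEN iffD2]) (intro sum_in_bigo cubic E'' cross)
qed

text \<open>The factor \<open>\<eta> ^ 4 < 1\<close> in the denominator only enlarges the error bound, and
\<open>\<epsilon> ^ 3\<close> is a constant multiple of \<open>1 / r powr (3 / 2)\<close>.\<close>

lemma bigO_on_bulkI:
  assumes "f \<in> O[bulk_filter](\<lambda>x. \<epsilon> x ^ 3 * w x ^ n)"
  shows "bigO_on_bulk p (\<lambda>\<eta> r k. f (r, k))
           (\<lambda>\<eta> r k. (1 + \<bar>delta r p k\<bar> ^ n) / (r powr (3 / 2) * \<eta> ^ 4))"
proof -
  obtain C where "C > 0" and "\<forall>\<^sub>F x in bulk_filter. norm (f x) \<le> C * norm (\<epsilon> x ^ 3 * w x ^ n)"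
    using assms by (rule landau_o.bigE)
  then obtain R where R: "\<And>r k. r \<ge> R \<Longrightarrow> k \<in> bulk r p 1 \<Longrightarrow>
      \<bar>f (r, k)\<bar> \<le> C * \<bar>\<epsilon> (r, k) ^ 3 * w (r, k) ^ n\<bar>"
    by (auto simp: eventually_bulk_filter_iff)
  define K where "K = C * (1 / sqrt p ^ 3 * 2 ^ n)"
  have "K > 0" using \<open>C > 0\<close> p_pos by (simp add: K_def)
  have bound: "\<bar>f (r, k) / ((1 + \<bar>delta r p k\<bar> ^ n) / (r powr (3 / 2) * \<eta> ^ 4))\<bar> \<le> K"
    if "0 < \<eta>" "\<eta> < 1" "r \<ge> max R 1" "k \<in> bulk r p \<eta>" for \<eta> r k
  proof -
    let ?d = "\<bar>delta r p k\<bar>"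
    have r: "r > 0" "r \<ge> R" using that by auto
    have "\<eta> * r powr (- 1 / 3) \<le> 1 * r powr (- 1 / 3)"
      using that by (intro mult_right_mono) auto
    then have "k \<in> bulk r p 1" using that(4) by (auto simp: bulk_def)
    have powr: "r powr (3 / 2) = sqrt r ^ 3"
    proof -
      have "sqrt r ^ 3 = (r powr (1 / 2)) ^ 3" using r by (simp add: powr_half_sqrt)
      also have "\<dots> = r powr (3 / 2)" using r by (subst powr_power) auto
      finally show ?thesis ..
    qed
    have "1 + ?d \<le> 2 * max 1 ?d" by simp
    then have "(1 + ?d) ^ n \<le> (2 * max 1 ?d) ^ n" by (intro power_mono) auto
    also have "\<dots> \<le> 2 ^ n * (1 + ?d ^ n)"
      unfolding power_mult_distrib by (intro mult_left_mono) (auto simp: max_def)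
    finally have w_le: "w (r, k) ^ n \<le> 2 ^ n * (1 + ?d ^ n)"
      by (simp add: w_def \<Delta>_def)
    have "\<epsilon> (r, k) ^ 3 = 1 / sqrt p ^ 3 * (1 / r powr (3 / 2))"
      unfolding powr \<epsilon>_def by (simp add: real_sqrt_mult power_mult_distrib power_divide)
    then have "\<bar>\<epsilon> (r, k) ^ 3 * w (r, k) ^ n\<bar>
        \<le> 1 / sqrt p ^ 3 * (1 / r powr (3 / 2)) * (2 ^ n * (1 + ?d ^ n))"
      using w_le w_ge_1[of "(r, k)"] r p_pos by (simp add: abs_mult divide_right_mono)
    then have "\<bar>f (r, k)\<bar> \<le> C * (1 / sqrt p ^ 3 * (1 / r powr (3 / 2)) * (2 ^ n * (1 + ?d ^ n)))"
      using R[OF r(2) \<open>k \<in> bulk r p 1\<close>] \<open>C > 0\<close>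
      by (meson mult_left_mono less_imp_le order_trans)
    also have "\<dots> = K * ((1 + ?d ^ n) / r powr (3 / 2))"
      by (simp add: K_def)
    also have "\<dots> \<le> K * ((1 + ?d ^ n) / (r powr (3 / 2) * \<eta> ^ 4))"
    proof -
      have "r powr (3 / 2) * \<eta> ^ 4 \<le> r powr (3 / 2) * 1"
        using that by (intro mult_left_mono power_le_one) auto
      then show ?thesis
        using \<open>K > 0\<close> that r by (intro mult_left_mono divide_left_mono) auto
    qed
    finally have le: "\<bar>f (r, k)\<bar> \<le> K * ((1 + ?d ^ n) / (r powr (3 / 2) * \<eta> ^ 4))" .
    have "0 < (1 + ?d ^ n) / (r powr (3 / 2) * \<eta> ^ 4)"
      using that r by (intro divide_pos_pos mult_pos_pos add_pos_nonneg) auto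
    with le show ?thesis
      by (simp only: abs_divide[of "f (r, k)"] abs_of_pos pos_divide_le_eq)
  qed
  have "Limsup at_top (\<lambda>r. SUP k\<in>bulk r p \<eta>.
      ereal \<bar>f (r, k) / ((1 + \<bar>delta r p k\<bar> ^ n) / (r powr (3 / 2) * \<eta> ^ 4))\<bar>) < ereal (K + 1)"
    if "\<eta> \<in> {0<..<1}" for \<eta>
  proof -
    have "Limsup at_top (\<lambda>r. SUP k\<in>bulk r p \<eta>.
      ereal \<bar>f (r, k) / ((1 + \<bar>delta r p k\<bar> ^ n) / (r powr (3 / 2) * \<eta> ^ 4))\<bar>) \<le> ereal K"
    proof (rule Limsup_bounded)
      show "\<forall>\<^sub>F r in at_top. (SUP k\<in>bulk r p \<eta>.
          ereal \<bar>f (r, k) / ((1 + \<bar>delta r p k\<bar> ^ n) / (r powr (3 / 2) * \<eta> ^ 4))\<bar>) \<le> ereal K"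
        using eventually_ge_at_top[of "max R 1"]
      proof eventually_elim
        case (elim r)
        from that have "0 < \<eta>" "\<eta> < 1" by auto
        from bound[OF this elim] show ?case
          by (intro SUP_least) (simp only: ereal_less_eq)
      qed
    qed
    then show ?thesis by (rule le_less_trans) simp
  qed
  \<comment> \<open>One more than \<open>K\<close>, since the limit superior has to be strictly smaller.\<close>
  then show ?thesis
    unfolding bigO_on_bulk_def using \<open>K > 0\<close> by (intro exI[of _ "K + 1"]) auto
qed

end

text \<open>The limit superior does not see \<open>r \<le> 0\<close>, and only positive \<open>r\<close> allow \<open>\<epsilon>\<close> to be rewritten as a real power of \<open>r * p\<close>.\<close>

lemma bigO_on_bulk_cong:
  assumes "bigO_on_bulk p u v"
    and "\<And>\<eta> r k. r > 0 \<Longrightarrow> u \<eta> r k = u' \<eta> r k"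
  shows "bigO_on_bulk p u' v"
proof -
  have "Limsup at_top (\<lambda>r. SUP k\<in>bulk r p \<eta>. ereal \<bar>u \<eta> r k / v \<eta> r k\<bar>)
      = Limsup at_top (\<lambda>r. SUP k\<in>bulk r p \<eta>. ereal \<bar>u' \<eta> r k / v \<eta> r k\<bar>)" for \<eta>
  proof (intro Limsup_eq)
    show "\<forall>\<^sub>F r in at_top. (SUP k\<in>bulk r p \<eta>. ereal \<bar>u \<eta> r k / v \<eta> r k\<bar>)
        = (SUP k\<in>bulk r p \<eta>. ereal \<bar>u' \<eta> r k / v \<eta> r k\<bar>)"
      using eventually_gt_at_top[of 0]
    proof eventually_elim
      case (elim r)
      then show ?case by (simp only: assms(2))
    qed
  qed
  then show ?thesis using assms(1) by (simp add: bigO_on_bulk_def)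
qed

theorem lemma1:
  fixes p q :: real
  assumes "0 < p" "p < 1" "q = 1 - p"
  shows "bigO_on_bulk p
      (\<lambda>\<eta> r k.
         ln (negbin_pmf r p k / (q / sqrt (r * p) * std_normal_density (delta r p k)))
         - ((r * p) powr (- 1 / 2) *
              ((1 + p) / 6 * delta r p k ^ 3 - (1 + p) / 2 * delta r p k)
            + inverse (r * p) *
              (- (1 + p + p\<^sup>2) / 12 * delta r p k ^ 4 + (p\<^sup>2 + 1) / 4 * (delta r p k)\<^sup>2
               - (p\<^sup>2 + q) / 12)))
      (\<lambda>\<eta> r k. (1 + \<bar>delta r p k\<bar> ^ 5) / (r powr (3 / 2) * \<eta> ^ 4))
    \<and> bigO_on_bulk p
      (\<lambda>\<eta> r k.
         negbin_pmf r p k / (q / sqrt (r * p) * std_normal_density (delta r p k))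
         - (1
            + (r * p) powr (- 1 / 2) *
              ((1 + p) / 6 * delta r p k ^ 3 - (1 + p) / 2 * delta r p k)
            + inverse (r * p) *
              ((1 + p)\<^sup>2 / 72 * delta r p k ^ 6 - (2 + 3 * p + 2 * p\<^sup>2) / 12 * delta r p k ^ 4
               + (3 + 2 * p + 3 * p\<^sup>2) / 8 * (delta r p k)\<^sup>2 - (p\<^sup>2 + q) / 12)))
      (\<lambda>\<eta> r k. (1 + \<bar>delta r p k\<bar> ^ 9) / (r powr (3 / 2) * \<eta> ^ 4))"
proof -
  interpret negbin_bulk p q using assms by unfold_locales
  have eps: "\<epsilon> (r, k) = (r * p) powr (- 1 / 2)" "(\<epsilon> (r, k))\<^sup>2 = inverse (r * p)" if "r > 0" for r k
  proof -
    have "0 \<le> r * p" using that p_pos by simp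
    then show "\<epsilon> (r, k) = (r * p) powr (- 1 / 2)"
      by (simp add: \<epsilon>_def powr_minus_divide powr_half_sqrt)
    show "(\<epsilon> (r, k))\<^sup>2 = inverse (r * p)"
      using eps_square[of "(r, k)"] that by (simp add: divide_inverse)
  qed
  have square: "(first_correction x)\<^sup>2 / 2 + second_correction x =
      (1 + p)\<^sup>2 / 72 * \<Delta> x ^ 6 - (2 + 3 * p + 2 * p\<^sup>2) / 12 * \<Delta> x ^ 4
      + (3 + 2 * p + 3 * p\<^sup>2) / 8 * (\<Delta> x)\<^sup>2 - (p\<^sup>2 + q) / 12" for x
    unfolding first_correction_def second_correction_def by (simp add: field_simps eval_nat_numeral)
  show ?thesis
  proof (intro conjI)
    show "bigO_on_bulk p
        (\<lambda>\<eta> r k.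
           ln (negbin_pmf r p k / (q / sqrt (r * p) * std_normal_density (delta r p k)))
           - ((r * p) powr (- 1 / 2) *
                ((1 + p) / 6 * delta r p k ^ 3 - (1 + p) / 2 * delta r p k)
              + inverse (r * p) *
                (- (1 + p + p\<^sup>2) / 12 * delta r p k ^ 4 + (p\<^sup>2 + 1) / 4 * (delta r p k)\<^sup>2
                 - (p\<^sup>2 + q) / 12)))
        (\<lambda>\<eta> r k. (1 + \<bar>delta r p k\<bar> ^ 5) / (r powr (3 / 2) * \<eta> ^ 4))"
      by (rule bigO_on_bulk_cong[OF bigO_on_bulkI[OF ln_ratio_expansion]])
         (simp only: eps(2) ratio_def first_correction_def second_correction_def \<Delta>_def
            fst_conv snd_conv, simp only: eps(1))
    show "bigO_on_bulk p
      (\<lambda>\<eta> r k.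
         negbin_pmf r p k / (q / sqrt (r * p) * std_normal_density (delta r p k))
         - (1
            + (r * p) powr (- 1 / 2) *
              ((1 + p) / 6 * delta r p k ^ 3 - (1 + p) / 2 * delta r p k)
            + inverse (r * p) *
              ((1 + p)\<^sup>2 / 72 * delta r p k ^ 6 - (2 + 3 * p + 2 * p\<^sup>2) / 12 * delta r p k ^ 4
               + (3 + 2 * p + 3 * p\<^sup>2) / 8 * (delta r p k)\<^sup>2 - (p\<^sup>2 + q) / 12)))
      (\<lambda>\<eta> r k. (1 + \<bar>delta r p k\<bar> ^ 9) / (r powr (3 / 2) * \<eta> ^ 4))"
      by (rule bigO_on_bulk_cong[OF bigO_on_bulkI[OF ratio_expansion[unfolded square]]])
         (simp only: eps(2) ratio_def first_correction_def \<Delta>_def fst_conv snd_conv, simp only: eps(1))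
  qed
qed

end
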